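(* Let $D$ be an integral domain and let $\tau_1$ and $\tau_2$ be relations on $D^{\#}$ such that $\tau_1$ is reflexive, $\tau_1\circ\tau_2\neq\emptyset$, $\tau_2\circ\tau_1\neq\emptyset$ and $\tau_1\subseteq\tau_2$. (1) If $\tau_2$ is an equivalence relation, then $\tau_1\circ\tau_2$ and $\tau_2\circ\tau_1$ are equivalence relations. (2) If $\tau_2$ is a partial order, then $\tau_1\circ\tau_2$ and $\tau_2\circ\tau_1$ are partial orders.
   Context: For an integral domain $D$, $D^{\#}$ denotes the set of nonzero nonunit elements of $D$. A relation on $D^{\#}$ is a subset of $D^{\#}\times D^{\#}$. Composition is defined by: $a\,(R_1\circ R_2)\,b$ if and only if there exists $c\in D^{\#}$ such that $a\,R_2\,c$ and $c\,R_1\,b$. Reflexive means reflexive on $D^{\#}$; equivalence relations and partial orders (reflexive, antisymmetric, transitive relations) are on $D^{\#}$. *)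

theory Defs
  imports Main
begin

definition nonzero_nonunits :: "'a::idom set" where
  "nonzero_nonunits = {x. x \<noteq> 0 \<and> \<not> x dvd 1}"

(* The right-hand argument acts first: R1 \<circ> R2 relates a to b when a R2 c and c R1 b.
   The library's relational composition O lists its arguments in the opposite order;
   see rel_compose_eq_relcomp. *)
definition rel_compose :: "('a::idom) rel \<Rightarrow> 'a rel \<Rightarrow> 'a rel"  (infixr "\<circ>\<^sub>R" 75) where
  "R1 \<circ>\<^sub>R R2 = {(a, b). \<exists>c\<in>nonzero_nonunits. (a, c) \<in> R2 \<and> (c, b) \<in> R1}"

lemma rel_compose_eq_relcomp:
  assumes "R2 \<subseteq> nonzero_nonunits \<times> nonzero_nonunits"
  shows "R1 \<circ>\<^sub>R R2 = R2 O R1"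
  using assms unfolding rel_compose_def by blast

end

theory Submission
  imports Defs
begin

text \<open>Sandwiched between the diagonal and a transitive relation \<open>T\<close>, a relation \<open>R\<close> is absorbed by
  \<open>T\<close> under composition on either side: composing with \<open>R\<close> can lose nothing, because \<open>R\<close> contains
  the diagonal, and can add nothing, because \<open>R \<subseteq> T\<close> and \<open>T\<close> is transitive. Equivalence relations
  and partial orders are both transitive, so in each part of the theorem the two composites are
  equal to \<open>\<tau>2\<close> itself and have whatever properties \<open>\<tau>2\<close> has.\<close>

lemma relcomp_absorb_reflexive_subrelation:
  assumes "refl_on A R" and "R \<subseteq> T" and "T \<subseteq> A \<times> A" and "trans T"
  shows "T O R = T" and "R O T = T"
proof -
  have "T O R \<subseteq> T" "R O T \<subseteq> T"
    using assms(2,4) by (auto dest: transD)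
  moreover have "T \<subseteq> T O R" "T \<subseteq> R O T"
    using assms(1,3) by (auto dest: refl_onD)
  ultimately show "T O R = T" "R O T = T"
    by blast+
qed

theorem mainTheorem6:
  fixes \<tau>1 \<tau>2 :: "('a::idom) rel"
  assumes "\<tau>1 \<subseteq> nonzero_nonunits \<times> nonzero_nonunits"
    and "\<tau>2 \<subseteq> nonzero_nonunits \<times> nonzero_nonunits"
    and "refl_on nonzero_nonunits \<tau>1"
    and "\<tau>1 \<circ>\<^sub>R \<tau>2 \<noteq> {}"
    and "\<tau>2 \<circ>\<^sub>R \<tau>1 \<noteq> {}"
    and "\<tau>1 \<subseteq> \<tau>2"
  shows "(equiv nonzero_nonunits \<tau>2 \<longrightarrow>
            equiv nonzero_nonunits (\<tau>1 \<circ>\<^sub>R \<tau>2) \<and>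
            equiv nonzero_nonunits (\<tau>2 \<circ>\<^sub>R \<tau>1)) \<and>
         (partial_order_on nonzero_nonunits \<tau>2 \<longrightarrow>
            partial_order_on nonzero_nonunits (\<tau>1 \<circ>\<^sub>R \<tau>2) \<and>
            partial_order_on nonzero_nonunits (\<tau>2 \<circ>\<^sub>R \<tau>1))"
proof -
  have absorb: "\<tau>1 \<circ>\<^sub>R \<tau>2 = \<tau>2 \<and> \<tau>2 \<circ>\<^sub>R \<tau>1 = \<tau>2" if "trans \<tau>2"
    using relcomp_absorb_reflexive_subrelation[OF assms(3,6,2) that]
    by (simp add: rel_compose_eq_relcomp assms(1,2))
  show ?thesis
  proof (intro conjI impI)
    assume eq: "equiv nonzero_nonunits \<tau>2"
    then have "trans \<tau>2" by (rule equivE)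
    with absorb eq show "equiv nonzero_nonunits (\<tau>1 \<circ>\<^sub>R \<tau>2)"
      and "equiv nonzero_nonunits (\<tau>2 \<circ>\<^sub>R \<tau>1)" by simp_all
  next
    assume po: "partial_order_on nonzero_nonunits \<tau>2"
    then have "trans \<tau>2"
      by (simp add: partial_order_on_def preorder_on_def)
    with absorb po show "partial_order_on nonzero_nonunits (\<tau>1 \<circ>\<^sub>R \<tau>2)"
      and "partial_order_on nonzero_nonunits (\<tau>2 \<circ>\<^sub>R \<tau>1)" by simp_all
  qed
qed

end
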